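(* Let $m\ge n$, let $A\in\mathbb{R}^{m\times n}$ with $\mathrm{rank}(A)=n$, let $b\in\mathbb{R}^m$, $c\in\mathbb{R}^n$, let $x\in\mathbb{R}^n$ be the exact solution of $A^\top A x=A^\top b+c$, and let $r=b-Ax$. Then the absolute condition number of the problem $A^\top A x=A^\top b+c$ at $(A,b,c)$ (with respect to perturbations of all of $A,b,c$), with Euclidean norm on the solution and Frobenius norm on the data, is $\sqrt{\|\bar M\|}$, where $\bar M\in\mathbb{R}^{n\times n}$ is given by $$\bar M=(1+\|r\|^2)(A^\top A)^{-2}+(1+\|x\|^2)(A^\top A)^{-1}-2\,\mathrm{sym}(B),$$ with $B=A^\dagger r x^\top (A^\top A)^{-1}$ and $\mathrm{sym}(B)=\frac12(B+B^\top)$.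
   Context: $\|\cdot\|$ denotes the Euclidean norm of vectors and the induced spectral norm of matrices; $\|\cdot\|_F$ is the Frobenius norm. $A^\dagger$ is the Moore-Penrose pseudoinverse of $A$; for full column rank $A$, $A^\dagger=(A^\top A)^{-1}A^\top$. The solution map is $F(A,b,c)=A^\dagger b+A^\dagger(A^\dagger)^\top c=(A^\top A)^{-1}(A^\top b+c)\in\mathbb{R}^n$, considered as a function of $(A,b,c)\in\mathbb{R}^{m\times n}\times\mathbb{R}^m\times\mathbb{R}^n$ with $A$ of full column rank (an open set). The data space $\mathbb{R}^{m\times n}\times\mathbb{R}^m\times\mathbb{R}^n$ carries the norm $\|[A,b,c]\|_F=\sqrt{\|A\|_F^2+\|b\|^2+\|c\|^2}$ and the solution space $\mathbb{R}^n$ carries the Euclidean norm. The absolute condition number of the problem at $(A,b,c)$ is the operator norm $\|F'(A,b,c)\|_{\mathrm{op}}$ of the (Fréchet) derivative of $F$ at $(A,b,c)$, induced by these two norms. *)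

theory Defs
  imports "HOL-Analysis.Analysis"
begin

text \<open>
  The norm of the type class on matrices is the Frobenius norm, and the product norm combines the
  three components of the data by the square root of the sum of squares.
\<close>

lemma norm_matrix_Frobenius:
  fixes A :: "real^'n^'m"
  shows "norm A = sqrt (\<Sum>i\<in>UNIV. \<Sum>j\<in>UNIV. (A $ i $ j)\<^sup>2)"
  by (simp add: norm_vec_def L2_set_def sum_nonneg)

lemma norm_data_Frobenius:
  fixes A :: "real^'n^'m" and b :: "real^'m" and c :: "real^'n"
  shows "norm (A, b, c) = sqrt ((norm A)\<^sup>2 + (norm b)\<^sup>2 + (norm c)\<^sup>2)"
  by (simp add: norm_prod_def add.assoc)

text \<open>The spectral norm (as opposed to the type class norm on matrices).\<close>

definition spectral_norm :: "real^'n^'m \<Rightarrow> real" where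
  "spectral_norm A = onorm (\<lambda>v. A *v v)"

text \<open>The four Penrose equations determine the Moore--Penrose pseudoinverse.\<close>

definition is_pinv :: "real^'n^'m \<Rightarrow> real^'m^'n \<Rightarrow> bool" where
  "is_pinv A X \<longleftrightarrow>
     A ** X ** A = A \<and> X ** A ** X = X \<and>
     transpose (A ** X) = A ** X \<and> transpose (X ** A) = X ** A"

definition pinv :: "real^'n^'m \<Rightarrow> real^'m^'n" where
  "pinv A = (THE X. is_pinv A X)"

lemma is_pinv_unique:
  assumes X: "is_pinv A X" and Y: "is_pinv A Y"
  shows "X = Y"
proof -
  have x: "A ** X ** A = A" "X ** A ** X = X" "transpose (A ** X) = A ** X" "transpose (X ** A) = X ** A"
    and y: "A ** Y ** A = A" "Y ** A ** Y = Y" "transpose (A ** Y) = A ** Y" "transpose (Y ** A) = Y ** A"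
    using X Y by (auto simp: is_pinv_def)
  have 1: "A ** X = A ** Y"
  proof -
    have "A ** X = (A ** Y) ** (A ** X)"
      using y(1) by (metis matrix_mul_assoc)
    also have "\<dots> = transpose ((A ** X) ** (A ** Y))"
      by (metis matrix_transpose_mul x(3) y(3))
    also have "\<dots> = transpose (A ** Y)"
      using x(1) by (metis matrix_mul_assoc)
    finally show ?thesis using y(3) by simp
  qed
  have 2: "X ** A = Y ** A"
  proof -
    have "X ** A = (X ** A) ** (Y ** A)"
      using y(1) by (metis matrix_mul_assoc)
    also have "\<dots> = transpose ((Y ** A) ** (X ** A))"
      by (metis matrix_transpose_mul x(4) y(4))
    also have "\<dots> = transpose (Y ** A)"
      using x(1) by (metis matrix_mul_assoc)
    finally show ?thesis using y(4) by simp
  qed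
  show ?thesis
    using 1 2 x(2) y(2) by (metis matrix_mul_assoc)
qed

lemma invertible_gram:
  fixes A :: "real^'n^'m"
  assumes "rank A = CARD('n)"
  shows "invertible (transpose A ** A)"
proof -
  have inj: "inj ((*v) A)"
    using assms by (simp add: full_rank_injective)
  have "v = 0" if "(transpose A ** A) *v v = 0" for v
  proof -
    have "(A *v v) \<bullet> (A *v v) = v \<bullet> ((transpose A ** A) *v v)"
      by (metis dot_lmul_matrix matrix_vector_mul_assoc transpose_matrix_vector inner_commute)
    then have "A *v v = 0"
      using that by simp
    then show "v = 0"
      using inj by (metis injD matrix_vector_mult_0_right)
  qed
  then show ?thesis
    by (metis invertible_left_inverse matrix_left_invertible_ker)
qed

lemma gram_inverse:
  fixes A :: "real^'n^'m"
  assumes "rank A = CARD('n)"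
  defines "G \<equiv> matrix_inv (transpose A ** A)"
  shows "G ** (transpose A ** A) = mat 1" "(transpose A ** A) ** G = mat 1" "transpose G = G"
proof -
  have "(transpose A ** A) ** G = mat 1 \<and> G ** (transpose A ** A) = mat 1"
    unfolding G_def matrix_inv_def
    by (rule someI_ex) (use invertible_gram[OF assms(1)] in \<open>simp add: invertible_def\<close>)
  then show l: "G ** (transpose A ** A) = mat 1" and r: "(transpose A ** A) ** G = mat 1"
    by auto
  have "transpose G ** (transpose A ** A) = mat 1"
    using arg_cong[OF r, of transpose]
    by (simp add: matrix_transpose_mul transpose_mat)
  then show "transpose G = G"
    by (metis r matrix_mul_assoc matrix_mul_lid matrix_mul_rid)
qed

lemma pinv_full_column_rank:
  fixes A :: "real^'n^'m"
  assumes "rank A = CARD('n)"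
  shows "pinv A = matrix_inv (transpose A ** A) ** transpose A"
proof -
  let ?G = "matrix_inv (transpose A ** A)"
  note G = gram_inverse[OF assms]
  have XA: "(?G ** transpose A) ** A = mat 1"
    using G(1) by (simp add: matrix_mul_assoc)
  have AX: "transpose (A ** (?G ** transpose A)) = A ** (?G ** transpose A)"
    by (simp add: matrix_transpose_mul G(3) matrix_mul_assoc)
  have "is_pinv A (?G ** transpose A)"
    unfolding is_pinv_def using XA AX
    by (metis matrix_mul_assoc matrix_mul_rid matrix_mul_lid transpose_mat)
  then show ?thesis
    unfolding pinv_def using is_pinv_unique by blast
qed

text \<open>
  The solution map is total here. Only its values on the open set of data with full column rank
  enter the derivative at a point of that set.
\<close>

definition solution_map :: "(real^'n^'m) \<times> (real^'m) \<times> (real^'n) \<Rightarrow> real^'n" where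
  "solution_map = (\<lambda>(A, b, c). pinv A *v b + (pinv A ** transpose (pinv A)) *v c)"

lemma solution_map_full_column_rank:
  fixes A :: "real^'n^'m"
  assumes "rank A = CARD('n)"
  shows "solution_map (A, b, c) = matrix_inv (transpose A ** A) *v (transpose A *v b + c)"
proof -
  let ?G = "matrix_inv (transpose A ** A)"
  note G = gram_inverse[OF assms]
  have "pinv A ** transpose (pinv A) = ?G ** (transpose A ** A) ** transpose ?G"
    by (simp add: pinv_full_column_rank[OF assms] matrix_transpose_mul matrix_mul_assoc)
  also have "\<dots> = ?G"
    by (simp add: G)
  finally show ?thesis
    by (simp add: solution_map_def pinv_full_column_rank[OF assms] matrix_vector_mul_assoc
        matrix_vector_right_distrib del: transpose_matrix_vector)
qed

text \<open>
  Meaningful only where the map is differentiable, since the library derivative is an arbitrary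
  choice elsewhere.
\<close>

definition abs_cond :: "('a::real_normed_vector \<Rightarrow> 'b::real_normed_vector) \<Rightarrow> 'a \<Rightarrow> real" where
  "abs_cond f z = onorm (frechet_derivative f (at z))"

definition sym_part :: "real^'n^'n \<Rightarrow> real^'n^'n" where
  "sym_part B = (1/2) *\<^sub>R (B + transpose B)"

end

theory Submission
  imports Defs
begin

text \<open>
  With \<open>G = (A\<^sup>T A)\<^sup>-\<^sup>1\<close>, the derivative of the solution map is
  \<open>L (E, f, g) = G (E\<^sup>T r - A\<^sup>T E x + A\<^sup>T f + g)\<close>. Its adjoint for the Frobenius inner product is
  \<open>L* u = (r w\<^sup>T - (A w) x\<^sup>T, A w, w)\<close> where \<open>w = G u\<close>, and expanding gives \<open>L L* = M\<close>, so the
  claim is the identity \<open>\<parallel>L L*\<parallel> = \<parallel>L\<parallel>\<^sup>2\<close>. Differentiability holds because Cramer's rule exhibits the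
  solution map as a rational function near data of full column rank.
\<close>

section \<open>Operator norms and adjoints\<close>

text \<open>Submultiplicativity together with \<open>onorm f = onorm g\<close> gives one inequality.
  The other comes from \<open>(norm (g y))^2 = f (g y) \<bullet> y\<close>, bounded by
  Cauchy-Schwarz. The adjoint is an argument because its explicit formula is what later produces
  \<open>M\<close>.\<close>

lemma onorm_comp_adjoint:
  fixes f :: "'a::real_inner \<Rightarrow> 'b::real_inner" and g :: "'b \<Rightarrow> 'a"
  assumes f: "bounded_linear f" and g: "bounded_linear g"
    and adj: "\<And>x y. f x \<bullet> y = x \<bullet> g y"
  shows "onorm (f \<circ> g) = (onorm f)\<^sup>2"
proof -
  \<comment> \<open>Stated over type variables of its own, so that it applies to the pair
    \<open>f\<close>, \<open>g\<close> and, with the spaces swapped, to \<open>g\<close>,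
    \<open>f\<close>.\<close>
  have le: "onorm h \<le> onorm k"
    if h: "bounded_linear h" and k: "bounded_linear k" and hk: "\<And>x y. h x \<bullet> y = x \<bullet> k y"
    for h :: "'c::real_inner \<Rightarrow> 'd::real_inner" and k :: "'d \<Rightarrow> 'c"
  proof (rule onorm_bound[OF onorm_pos_le[OF k]])
    fix x
    have "norm (h x) * norm (h x) = x \<bullet> k (h x)"
      using hk[of x "h x"] by (simp add: dot_square_norm power2_eq_square)
    also have "\<dots> \<le> norm x * norm (k (h x))"
      by (rule norm_cauchy_schwarz)
    also have "\<dots> \<le> norm x * (onorm k * norm (h x))"
      by (intro mult_left_mono onorm[OF k]) simp
    finally have "norm (h x) * norm (h x) \<le> (onorm k * norm x) * norm (h x)"
      by (simp add: ac_simps)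
    then show "norm (h x) \<le> onorm k * norm x"
      by (cases "norm (h x) = 0") (auto simp: onorm_pos_le[OF k] mult_le_cancel_right)
  qed
  have eq: "onorm f = onorm g"
    by (rule antisym; rule le) (use f g adj in \<open>auto simp: inner_commute\<close>)
  have fg: "bounded_linear (f \<circ> g)"
    unfolding comp_def using f g by (rule bounded_linear_compose)
  have "onorm (f \<circ> g) \<le> (onorm f)\<^sup>2"
    using onorm_compose[OF f g] eq by (simp add: power2_eq_square)
  moreover have "onorm g \<le> sqrt (onorm (f \<circ> g))"
  proof (rule onorm_bound)
    fix y
    have "(norm (g y))\<^sup>2 = (f \<circ> g) y \<bullet> y"
      by (simp add: adj dot_square_norm)
    also have "\<dots> \<le> norm ((f \<circ> g) y) * norm y"
      by (rule norm_cauchy_schwarz)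
    also have "\<dots> \<le> (onorm (f \<circ> g) * norm y) * norm y"
      by (intro mult_right_mono onorm[OF fg]) simp
    finally have "(norm (g y))\<^sup>2 \<le> onorm (f \<circ> g) * (norm y)\<^sup>2"
      by (simp add: power2_eq_square)
    then show "norm (g y) \<le> sqrt (onorm (f \<circ> g)) * norm y"
      by (metis norm_ge_zero real_le_rsqrt real_sqrt_mult real_sqrt_unique)
  qed (simp add: onorm_pos_le[OF fg])
  then have "(onorm g)\<^sup>2 \<le> onorm (f \<circ> g)"
    using onorm_pos_le[OF fg] onorm_pos_le[OF g]
    by (metis power_mono real_sqrt_pow2)
  ultimately show ?thesis
    using eq by simp
qed

section \<open>Differentiability of determinants and matrix operations\<close>

lemma differentiable_prod:
  fixes f :: "'i \<Rightarrow> 'a::real_normed_vector \<Rightarrow> real"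
  assumes "\<And>i. i \<in> I \<Longrightarrow> f i differentiable (at z within S)"
  shows "(\<lambda>z. \<Prod>i\<in>I. f i z) differentiable (at z within S)"
  using assms by (induction I rule: infinite_finite_induct) (auto intro!: differentiable_mult)

text \<open>By the Leibniz formula the determinant is a polynomial in the entries.\<close>

lemma differentiable_det:
  fixes f :: "'a::real_normed_vector \<Rightarrow> real^'n^'n"
  assumes "\<And>i j. (\<lambda>z. f z $ i $ j) differentiable at z"
  shows "(\<lambda>z. det (f z)) differentiable at z"
  unfolding det_def
  by (intro differentiable_sum ballI differentiable_mult differentiable_const
      differentiable_prod assms) simp

lemma differentiable_vec_nth:
  fixes f :: "'a::real_normed_vector \<Rightarrow> 'b::real_normed_vector^'n"
  shows "f differentiable F \<Longrightarrow> (\<lambda>z. f z $ i) differentiable F"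
  unfolding differentiable_def
  by (blast intro: bounded_linear.has_derivative[OF bounded_linear_vec_nth])

text \<open>Gives the product rule for matrix-vector products in which both factors vary.\<close>

lemma bounded_bilinear_matrix_vector:
  "bounded_bilinear ((*v) :: real^'n^'m \<Rightarrow> real^'n \<Rightarrow> real^'m)"
  unfolding bilinear_conv_bounded_bilinear[symmetric] bilinear_def
  by (auto intro!: linearI
      simp: matrix_vector_right_distrib matrix_vector_mult_add_rdistrib
        matrix_vector_mult_scaleR scaleR_matrix_vector_assoc)

lemma bounded_linear_transpose: "bounded_linear (transpose :: real^'n^'m \<Rightarrow> real^'m^'n)"
  unfolding linear_conv_bounded_linear[symmetric]
  by (auto intro!: linearI simp: transpose_def vec_eq_iff)

text \<open>A left inverse of the Gram matrix yields one of \<open>A\<close>, so \<open>A\<close> is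
  injective. This turns the open condition on the determinant into full rank nearby.\<close>

lemma rank_full_if_det_gram:
  fixes A :: "real^'n^'m"
  assumes "det (transpose A ** A) \<noteq> 0"
  shows "rank A = CARD('n)"
proof -
  obtain G where "G ** (transpose A ** A) = mat 1"
    using assms by (metis invertible_det_nz invertible_left_inverse)
  then have "(G ** transpose A) ** A = mat 1"
    by (simp add: matrix_mul_assoc)
  then show ?thesis
    by (metis full_rank_injective matrix_left_invertible_injective)
qed

section \<open>Rank-one matrices\<close>

definition outer :: "real^'m \<Rightarrow> real^'n \<Rightarrow> real^'n^'m" where
  "outer u v = (\<chi> i j. u $ i * v $ j)"

lemma outer_matrix_vector [simp]: "outer u v *v w = (v \<bullet> w) *\<^sub>R u"
  by (simp add: outer_def vec_eq_iff matrix_vector_mult_def inner_vec_def sum_distrib_left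
      sum_distrib_right ac_simps)

lemma transpose_outer: "transpose (outer u v) = outer v u"
  by (simp add: outer_def vec_eq_iff transpose_def)

text \<open>The inner product on matrices is the Frobenius one, and the trace of
  \<open>E^T u v^T\<close> is \<open>u^T E v\<close>. This isolates the perturbation
  \<open>E\<close> when the adjoint is computed.\<close>

lemma inner_outer: "E \<bullet> outer u v = u \<bullet> (E *v v)"
  by (simp add: outer_def matrix_vector_mult_def inner_vec_def sum_distrib_left ac_simps)

text \<open>Connects the one-column and one-row factors in which \<open>B\<close> is given with
  \<open>outer\<close>.\<close>

lemma columnvector_rowvector:
  "(columnvector u :: real^1^'m) ** (rowvector v :: real^'n^1) = outer u v"
  by (simp add: outer_def vec_eq_iff matrix_matrix_mult_def columnvector_def rowvector_def)

lemma inner_transpose_matrix_vector: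
  fixes A :: "real^'n^'m"
  shows "(transpose A *v u) \<bullet> v = u \<bullet> (A *v v)"
  by (metis dot_lmul_matrix transpose_matrix_vector)

declare transpose_matrix_vector [simp del]

section \<open>Derivative of the solution map\<close>

lemma solution_map_differentiable:
  fixes A :: "real^'n^'m"
  assumes "rank A = CARD('n)"
  shows "solution_map differentiable (at (A, b, c))"
    and "\<forall>\<^sub>F z in at (A, b, c). rank (fst z) = CARD('n)"
proof -
  let ?z = "(A, b, c)"
  let ?N = "\<lambda>z :: (real^'n^'m) \<times> (real^'m) \<times> (real^'n). transpose (fst z) ** fst z"
  let ?y = "\<lambda>z :: (real^'n^'m) \<times> (real^'m) \<times> (real^'n). transpose (fst z) *v fst (snd z) + snd (snd z)"
  have A_diff: "(\<lambda>z :: (real^'n^'m) \<times> (real^'m) \<times> (real^'n). fst z $ i $ j) differentiable at ?z" for i j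
    by (intro differentiable_vec_nth bounded_linear_imp_differentiable bounded_linear_fst)
  have b_diff: "(\<lambda>z :: (real^'n^'m) \<times> (real^'m) \<times> (real^'n). fst (snd z) $ i) differentiable at ?z" for i
    by (intro differentiable_vec_nth bounded_linear_imp_differentiable
        bounded_linear_fst_comp bounded_linear_snd)
  have c_diff: "(\<lambda>z :: (real^'n^'m) \<times> (real^'m) \<times> (real^'n). snd (snd z) $ i) differentiable at ?z" for i
    by (intro differentiable_vec_nth bounded_linear_imp_differentiable
        bounded_linear_snd_comp bounded_linear_snd)
  have N_diff: "(\<lambda>z. ?N z $ i $ j) differentiable at ?z" for i j
    by (simp add: matrix_matrix_mult_def transpose_def)
      (intro differentiable_sum ballI differentiable_mult A_diff; simp)
  have y_diff: "(\<lambda>z. ?y z $ i) differentiable at ?z" for i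
    by (simp add: matrix_vector_mult_def transpose_def)
      (intro differentiable_add differentiable_sum ballI differentiable_mult A_diff b_diff c_diff; simp)
  have det_diff: "(\<lambda>z. det (?N z)) differentiable at ?z"
    by (intro differentiable_det N_diff)
  have det0: "det (?N ?z) \<noteq> 0"
    using invertible_gram[OF assms] by (simp add: invertible_det_nz)
  \<comment> \<open>The filter is \<open>nhds\<close> because replacing Cramer's formula by the
    solution map also needs equality at the point itself.\<close>
  have ev: "\<forall>\<^sub>F z in nhds ?z. det (?N z) \<noteq> 0"
    using differentiable_imp_continuous_within[OF det_diff] det0
    by (simp add: isCont_def tendsto_nhds_iff tendsto_imp_eventually_ne)
  then have rk: "\<forall>\<^sub>F z in nhds ?z. rank (fst z) = CARD('n)"
    by eventually_elim (rule rank_full_if_det_gram)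
  then show "\<forall>\<^sub>F z in at ?z. rank (fst z) = CARD('n)"
    by (simp add: eventually_nhds_conv_at)
  \<comment> \<open>Cramer's formula for the system with matrix \<open>?N z\<close> and right-hand
    side \<open>?y z\<close>: column \<open>k\<close> is replaced by \<open>?y z\<close>.\<close>
  let ?C = "\<lambda>z. \<chi> k. det (\<chi> i j. if j = k then ?y z $ i else ?N z $ i $ j) / det (?N z)"
  have "?C differentiable at ?z"
  proof (subst differentiable_componentwise_within, intro ballI)
    fix e :: "real^'n" assume "e \<in> Basis"
    then obtain k where e: "e = axis k 1"
      by (auto simp: Basis_vec_def)
    have "(\<lambda>z. if j = k then ?y z $ i else ?N z $ i $ j) differentiable at ?z" for i j
      using y_diff N_diff by (cases "j = k") auto
    then have "(\<lambda>z. det (\<chi> i j. if j = k then ?y z $ i else ?N z $ i $ j)) differentiable at ?z"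
      by (intro differentiable_det) simp
    then have "(\<lambda>z. det (\<chi> i j. if j = k then ?y z $ i else ?N z $ i $ j) / det (?N z)) differentiable at ?z"
      using det_diff det0 by (intro differentiable_divide) auto
    then show "(\<lambda>z. ?C z \<bullet> e) differentiable at ?z"
      by (simp add: e inner_axis)
  qed
  then obtain D where D: "(?C has_derivative D) (at ?z)"
    unfolding differentiable_def by blast
  have C: "\<forall>\<^sub>F z in nhds ?z. ?C z = solution_map z"
    using ev rk
  proof eventually_elim
    case (elim z)
    obtain A' b' c' where z: "z = (A', b', c')"
      by (cases z)
    have "?N z *v solution_map z = ?y z"
      using elim(2) gram_inverse(2)[of A']
      by (simp add: z solution_map_full_column_rank matrix_vector_mul_assoc)
    then show ?case
      using cramer[OF elim(1)] by metis
  qed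
  have "(solution_map has_derivative D) (at ?z)"
    by (rule has_derivative_transform_eventually[OF D])
      (use C in \<open>simp_all only: eventually_nhds_conv_at UNIV_I\<close>)
  then show "solution_map differentiable at ?z"
    by (rule differentiableI)
qed

text \<open>
  The derivative is read off by differentiating the identity
  \<open>A\<^sup>T (b - A F(A,b,c)) + c = 0\<close>, which holds near data of full column rank.
\<close>

lemma solution_map_has_derivative:
  fixes A :: "real^'n^'m"
  assumes rk: "rank A = CARD('n)"
    and x: "(transpose A ** A) *v x = transpose A *v b + c"
    and r: "r = b - A *v x"
  shows "(solution_map has_derivative
      (\<lambda>(E, f, g). matrix_inv (transpose A ** A) *v
         (transpose E *v r - transpose A *v (E *v x) + transpose A *v f + g))) (at (A, b, c))"
proof -
  let ?G = "matrix_inv (transpose A ** A)"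
  let ?z = "(A, b, c)"
  note G = gram_inverse[OF rk]
  obtain D where D: "(solution_map has_derivative D) (at ?z)"
    using solution_map_differentiable(1)[OF rk] unfolding differentiable_def by blast
  have normal: "transpose A' *v (b' - A' *v solution_map (A', b', c')) + c' = 0"
    if "rank A' = CARD('n)" for A' :: "real^'n^'m" and b' c'
  proof -
    have "(transpose A' ** A') *v solution_map (A', b', c') = transpose A' *v b' + c'"
      using gram_inverse(2)[OF that]
      by (simp add: solution_map_full_column_rank that matrix_vector_mul_assoc)
    then show ?thesis
      by (simp add: matrix_vector_mul_assoc[symmetric] matrix_vector_mult_diff_distrib)
  qed
  have Fx: "solution_map ?z = x"
    using G(1) x[symmetric] by (simp add: solution_map_full_column_rank[OF rk] matrix_vector_mul_assoc)
  \<comment> \<open>The normal equation in residual form: at the given data the bracket equals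
    \<open>r\<close>, and no derivative of the matrix inverse has to be computed.\<close>
  let ?\<Phi> = "\<lambda>z. transpose (fst z) *v (fst (snd z) - fst z *v solution_map z) + snd (snd z)"
  have "(?\<Phi> has_derivative
      (\<lambda>h. transpose A *v (fst (snd h) - (A *v D h + fst h *v x)) + transpose (fst h) *v r + snd (snd h))) (at ?z)"
    by (auto intro!: derivative_eq_intros D bounded_bilinear.FDERIV[OF bounded_bilinear_matrix_vector]
        bounded_linear.has_derivative[OF bounded_linear_transpose] simp: Fx r)
  \<comment> \<open>\<open>?\<Phi>\<close> vanishes near the data. Uniqueness of the derivative then
    gives a linear equation for \<open>D h\<close>, which \<open>?G\<close> solves.\<close>
  moreover have "(?\<Phi> has_derivative (\<lambda>_. 0)) (at ?z)"
  proof (rule has_derivative_transform_eventually[OF has_derivative_const])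
    show "\<forall>\<^sub>F z in at ?z. 0 = ?\<Phi> z"
      using solution_map_differentiable(2)[OF rk]
      by eventually_elim (metis normal prod.collapse)
  qed (use normal[OF rk] in auto)
  ultimately have eq: "transpose A *v (fst (snd h) - (A *v D h + fst h *v x)) + transpose (fst h) *v r + snd (snd h) = 0" for h
    by (rule fun_cong[OF has_derivative_unique])
  have "D = (\<lambda>(E, f, g). ?G *v (transpose E *v r - transpose A *v (E *v x) + transpose A *v f + g))"
  proof (rule ext, clarify)
    fix E f g
    have "(transpose A ** A) *v D (E, f, g) = transpose E *v r - transpose A *v (E *v x) + transpose A *v f + g"
      using eq[of "(E, f, g)"]
      by (simp add: matrix_vector_mul_assoc[symmetric] matrix_vector_mult_diff_distrib
          matrix_vector_right_distrib algebra_simps)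
    then show "D (E, f, g) = ?G *v (transpose E *v r - transpose A *v (E *v x) + transpose A *v f + g)"
      using G(1) by (metis matrix_vector_mul_assoc matrix_vector_mul_lid)
  qed
  then show ?thesis
    using D by simp
qed

section \<open>The condition number\<close>

theorem theorem3p3:
  fixes A :: "real^'n^'m" and b r :: "real^'m" and c x :: "real^'n"
    and B M :: "real^'n^'n"
  assumes "CARD('m) \<ge> CARD('n)"
    and "rank A = CARD('n)"
    and "(transpose A ** A) *v x = transpose A *v b + c"
    and "r = b - A *v x"
    and "B = pinv A ** (columnvector r :: real^1^'m) ** (rowvector x :: real^'n^1) ** matrix_inv (transpose A ** A)"
    and "M = (1 + (norm r)\<^sup>2) *\<^sub>R (matrix_inv (transpose A ** A) ** matrix_inv (transpose A ** A))
           + (1 + (norm x)\<^sup>2) *\<^sub>R matrix_inv (transpose A ** A)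
           - 2 *\<^sub>R sym_part B"
  shows "solution_map differentiable (at (A, b, c))
       \<and> abs_cond solution_map (A, b, c) = sqrt (spectral_norm M)"
proof
  let ?G = "matrix_inv (transpose A ** A)"
  let ?L = "\<lambda>(E, f, g). ?G *v (transpose E *v r - transpose A *v (E *v x) + transpose A *v f + g)"
  let ?adj = "\<lambda>u. (outer r (?G *v u) - outer (A *v (?G *v u)) x, A *v (?G *v u), ?G *v u)"
  note G = gram_inverse[OF assms(2)]
  note D = solution_map_has_derivative[OF assms(2-4)]
  show "solution_map differentiable (at (A, b, c))"
    by (rule solution_map_differentiable) (rule assms)
  have G_inner: "(?G *v u) \<bullet> v = u \<bullet> (?G *v v)" for u v
    using inner_transpose_matrix_vector[of ?G u v] G(3) by simp
  \<comment> \<open>With \<open>w = ?G *v u\<close>, the two terms in \<open>E\<close> pair with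
    \<open>w\<close> as \<open>E \<bullet> outer r w\<close> and
    \<open>E \<bullet> outer (A *v w) x\<close>; the term in \<open>f\<close> pairs as
    \<open>f \<bullet> (A *v w)\<close>.\<close>
  have adj: "?L h \<bullet> u = h \<bullet> ?adj u" for h u
    by (cases h) (simp add: G_inner inner_diff_left inner_diff_right inner_add_left inner_add_right
        inner_transpose_matrix_vector inner_outer inner_commute[of r]
        inner_commute[of _ "A *v _"])
  have BL: "bounded_linear ?L"
    using D by (rule has_derivative_bounded_linear)
  have "linear ?adj"
    by (rule linearI)
      (auto simp: outer_def vec_eq_iff matrix_vector_right_distrib matrix_vector_mult_scaleR algebra_simps)
  then have BA: "bounded_linear ?adj"
    by (simp add: linear_conv_bounded_linear)
  have B: "B = ?G ** transpose A ** outer r x ** ?G"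
    by (simp add: assms(5) pinv_full_column_rank[OF assms(2)] columnvector_rowvector[symmetric] matrix_mul_assoc)
  have Bt: "transpose B = ?G ** outer x r ** A ** ?G"
    by (simp add: B matrix_transpose_mul transpose_outer G(3) matrix_mul_assoc)
  have "(?L \<circ> ?adj) u = M *v u" for u
  proof -
    let ?w = "?G *v u"
    have cancel: "?G *v (transpose A *v (A *v v)) = v" for v
      using G(1) by (metis matrix_vector_mul_assoc matrix_vector_mul_lid)
    have Bu: "B *v u = (x \<bullet> ?w) *\<^sub>R (?G *v (transpose A *v r))"
      by (simp add: B matrix_vector_mul_assoc[symmetric] matrix_vector_mult_scaleR)
    have Btu: "transpose B *v u = (r \<bullet> (A *v ?w)) *\<^sub>R (?G *v x)"
      by (simp add: Bt matrix_vector_mul_assoc[symmetric] matrix_vector_mult_scaleR)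
    have "M *v u = (1 + (norm r)\<^sup>2) *\<^sub>R (?G *v ?w) + (1 + (norm x)\<^sup>2) *\<^sub>R ?w
        - (B *v u + transpose B *v u)"
      by (simp add: assms(6) sym_part_def matrix_vector_mult_add_rdistrib
          matrix_vector_mult_diff_rdistrib scaleR_matrix_vector_assoc[symmetric] matrix_vector_mul_assoc)
    \<comment> \<open>The diagonal terms collapse by \<open>cancel\<close> and the squared norms of
      \<open>r\<close> and \<open>x\<close>; the cross terms \<open>x \<bullet> ?w\<close> and
      \<open>r \<bullet> (A *v ?w)\<close> are those of \<open>B\<close> and its transpose.\<close>
    also have "\<dots> = (?L \<circ> ?adj) u"
      by (simp add: Bu Btu transpose_outer matrix_vector_mult_diff_rdistrib
          linear_diff[OF bounded_linear.linear[OF bounded_linear_transpose]] cancel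
          matrix_vector_mult_diff_distrib matrix_vector_right_distrib matrix_vector_mult_scaleR
          dot_square_norm inner_commute algebra_simps)
    finally show ?thesis
      by simp
  qed
  then have "spectral_norm M = (onorm ?L)\<^sup>2"
    using onorm_comp_adjoint[OF BL BA adj] by (simp add: spectral_norm_def comp_def)
  \<comment> \<open>Derivatives are unique, so the one chosen by \<open>frechet_derivative\<close>
    is \<open>?L\<close>.\<close>
  moreover have "abs_cond solution_map (A, b, c) = onorm ?L"
    using frechet_derivative_at[OF D] by (simp add: abs_cond_def)
  ultimately show "abs_cond solution_map (A, b, c) = sqrt (spectral_norm M)"
    using onorm_pos_le[OF BL] by simp
qed

end
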